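(* Let $\{k,\bar k\}=\{1,2\}$, let $g_k,g_{\bar k}$ be normalized channel gains, $\hat P$ the peak power, $\bar R_k,\bar R_{\bar k}$ target rates, and let a triple $(\lambda,\delta,\mu)$ with $\lambda,\delta,\mu\ge0$ be given. Consider the problem of minimizing $$\bar{\mathcal L}(p_k,p_{\bar k},\alpha_k)=\bar R_kX_k+\bar R_{\bar k}X_{\bar k}+\lambda(p_k+p_{\bar k})+\delta X_k+\mu X_{\bar k}$$ subject to $p_k\ge0$, $p_{\bar k}\ge0$, $p_k+p_{\bar k}\le\hat P$ and $0\le\alpha_k\le1$ (and likewise $0\le\alpha_{\bar k}\le 1$, where $\alpha_{\bar k}=1-\alpha_k$), where $X_k,X_{\bar k}\in\{0,1\}$ are the OMA-Type-II outage indicators defined in the context. Then the optimal allocation is $$(p_k^\ast,p_{\bar k}^\ast,\alpha_k^\ast)=\arg\min_{i\in\{1,2,3,4\}}\big\{\bar{\mathcal L}(p_{i,k},p_{i,\bar k},\alpha_{i,k})\,\mathbb 1_{p_{i,k}+p_{i,\bar k}}\big\},$$ where $\mathbb 1_x=1$ if $0\le x\le\hat P$ and $\mathbb 1_x=0$ otherwise, and $$\begin{aligned} &p_{1,k}=0,\ \ p_{1,\bar k}=0,\ \ \alpha_{1,k}=0;\\ &p_{2,k}=\tfrac{2^{\bar R_k}-1}{g_k},\ \ p_{2,\bar k}=0,\ \ \alpha_{2,k}=1;\\ &p_{3,k}=0,\ \ p_{3,\bar k}=\tfrac{2^{\bar R_{\bar k}}-1}{g_{\bar k}},\ \ \alpha_{3,k}=0;\\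 &p_{4,k}=\tfrac{\alpha_k^\ast(2^{\bar R_k/\alpha_k^\ast}-1)}{g_k},\ \ p_{4,\bar k}=\tfrac{\alpha_{\bar k}^\ast(2^{\bar R_{\bar k}/\alpha_{\bar k}^\ast}-1)}{g_{\bar k}},\ \ \alpha_{4,k}=\alpha_k^\ast. \end{aligned}$$ In this list of four candidates, $\alpha_k^\ast$ (and $\alpha_{\bar k}^\ast=1-\alpha_k^\ast$) denotes the optimum proportion of time/frequency resource that minimizes the instantaneous total transmit power, obtained by solving the (convex) problem of minimizing $$\frac{\alpha_k\big(2^{\bar R_k/\alpha_k}-1\big)}{g_k}+\frac{\alpha_{\bar k}\big(2^{\bar R_{\bar k}/\alpha_{\bar k}}-1\big)}{g_{\bar k}}$$ over $0\le\alpha_k\le1$, with $\alpha_{\bar k}=1-\alpha_k$.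
   Context: Fix a fading state of a two-user downlink system with normalized channel gains $g_k,g_{\bar k}$ and target rates $\bar R_k,\bar R_{\bar k}$. In the OMA-Type-II scheme user $j\in\{k,\bar k\}$ receives a fraction $\alpha_j\in[0,1]$ of the time/frequency resource, $\alpha_k+\alpha_{\bar k}=1$, and has rate $R_j=\alpha_j\log_2\big(1+\frac{p_jg_j}{\alpha_j}\big)$, with $R_j=0$ if $\alpha_j=0$. The outage indicator is $X_j=1$ if $R_j<\bar R_j$ and $X_j=0$ otherwise. The objective $\bar{\mathcal L}$ is the per-fading-state (negated) Lagrangian of the maximization of the sum of delay-limited throughput: $\lambda$ is the multiplier of the average power constraint, $\delta$ and $\mu$ those of the maximum outage probability constraints of users $k$ and $\bar k$, and $\hat P$ is the peak total power.
   Formalization: The indicator in the arg min is read as excluding candidates whose total power exceeds the peak power, not as multiplying the objective by 0; with the literal product an infeasible candidate would get value 0 and be selected. *)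

theory Defs
  imports "HOL-Analysis.Analysis"
begin

definition oma_rate :: "real \<Rightarrow> real \<Rightarrow> real \<Rightarrow> real" where
  "oma_rate g \<alpha> p = (if \<alpha> = 0 then 0 else \<alpha> * log 2 (1 + p * g / \<alpha>))"

definition outage :: "real \<Rightarrow> real \<Rightarrow> real \<Rightarrow> real \<Rightarrow> real" where
  "outage g R \<alpha> p = (if oma_rate g \<alpha> p < R then 1 else 0)"

text \<open>Users are labelled by natural numbers; \<open>g\<close> and \<open>R\<close> give the channel gain and the target
  rate of each user, and \<open>k\<close>, \<open>k'\<close> are the two users.  An allocation is a triple
  \<open>(p\<^sub>k, p\<^sub>k\<^sub>', \<alpha>\<^sub>k)\<close>; the share of user \<open>k'\<close> is \<open>1 - \<alpha>\<^sub>k\<close>.\<close>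

definition lagrangian ::
    "(nat \<Rightarrow> real) \<Rightarrow> (nat \<Rightarrow> real) \<Rightarrow> nat \<Rightarrow> nat \<Rightarrow> real \<Rightarrow> real \<Rightarrow> real \<Rightarrow> real \<times> real \<times> real \<Rightarrow> real" where
  "lagrangian g R k k' lam \<delta> \<mu> = (\<lambda>(p, p', \<alpha>).
     let X = outage (g k) (R k) \<alpha> p; X' = outage (g k') (R k') (1 - \<alpha>) p'
     in R k * X + R k' * X' + lam * (p + p') + \<delta> * X + \<mu> * X')"

definition feasible :: "real \<Rightarrow> real \<times> real \<times> real \<Rightarrow> bool" where
  "feasible Phat = (\<lambda>(p, p', \<alpha>). 0 \<le> p \<and> 0 \<le> p' \<and> p + p' \<le> Phat \<and>
     0 \<le> \<alpha> \<and> \<alpha> \<le> 1 \<and> 0 \<le> 1 - \<alpha> \<and> 1 - \<alpha> \<le> 1)"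

definition share_power :: "real \<Rightarrow> real \<Rightarrow> real \<Rightarrow> real" where
  "share_power g R \<alpha> = \<alpha> * (2 powr (R / \<alpha>) - 1) / g"

text \<open>At \<open>\<alpha> = 0\<close> the formula for \<open>share_power\<close> is meaningless (division by zero returns 0),
  so the value there is the limit as \<open>\<alpha>\<close> tends to 0 from the right: infinite for a positive
  target rate, 0 for a zero target rate.\<close>

definition share_power_ext :: "real \<Rightarrow> real \<Rightarrow> real \<Rightarrow> ereal" where
  "share_power_ext g R \<alpha> =
     (if \<alpha> = 0 then (if R = 0 then 0 else \<infinity>) else ereal (share_power g R \<alpha>))"

definition total_power ::
    "(nat \<Rightarrow> real) \<Rightarrow> (nat \<Rightarrow> real) \<Rightarrow> nat \<Rightarrow> nat \<Rightarrow> real \<Rightarrow> ereal" where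
  "total_power g R k k' \<alpha> =
     share_power_ext (g k) (R k) \<alpha> + share_power_ext (g k') (R k') (1 - \<alpha>)"

text \<open>Counterpart of \<open>convex_on\<close>, which is restricted to real-valued functions.\<close>

definition ereal_convex_on :: "real set \<Rightarrow> (real \<Rightarrow> ereal) \<Rightarrow> bool" where
  "ereal_convex_on S f \<longleftrightarrow> convex S \<and>
     (\<forall>x\<in>S. \<forall>y\<in>S. \<forall>u\<ge>0. \<forall>v\<ge>0. u + v = 1 \<longrightarrow>
        f (u * x + v * y) \<le> ereal u * f x + ereal v * f y)"

text \<open>The candidates \<open>i = 1, 2, 3, 4\<close>, where \<open>a\<close> is a minimizer of \<open>total_power\<close> over \<open>[0, 1]\<close>.
  Such a minimizer gives a zero share only to a user with zero target rate, so in the fourth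
  candidate the real-valued \<open>share_power\<close> always agrees with \<open>share_power_ext\<close>.\<close>

definition candidate ::
    "(nat \<Rightarrow> real) \<Rightarrow> (nat \<Rightarrow> real) \<Rightarrow> nat \<Rightarrow> nat \<Rightarrow> real \<Rightarrow> nat \<Rightarrow> real \<times> real \<times> real" where
  "candidate g R k k' a i =
     (if i = 1 then (0, 0, 0)
      else if i = 2 then ((2 powr R k - 1) / g k, 0, 1)
      else if i = 3 then (0, (2 powr R k' - 1) / g k', 0)
      else (share_power (g k) (R k) a, share_power (g k') (R k') (1 - a), a))"

definition peak_indicator :: "real \<Rightarrow> real \<times> real \<times> real \<Rightarrow> real" where
  "peak_indicator Phat = (\<lambda>(p, p', \<alpha>). if 0 \<le> p + p' \<and> p + p' \<le> Phat then 1 else 0)"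

text \<open>The arg min over the candidates weighted by the indicator.  An indicator value 0 excludes a
  candidate from the comparison.  It must not be read as multiplying the objective by 0: the
  objective is nonnegative, so a candidate violating the peak power constraint would then always
  attain the minimum.\<close>

definition best_candidate ::
    "(nat \<Rightarrow> real) \<Rightarrow> (nat \<Rightarrow> real) \<Rightarrow> nat \<Rightarrow> nat \<Rightarrow> real \<Rightarrow> real \<Rightarrow> real \<Rightarrow> real \<Rightarrow> real \<Rightarrow> nat \<Rightarrow> bool" where
  "best_candidate g R k k' lam \<delta> \<mu> Phat a =
     is_arg_min (\<lambda>i. lagrangian g R k k' lam \<delta> \<mu> (candidate g R k k' a i))
       (\<lambda>i. i \<in> {1, 2, 3, 4} \<and> peak_indicator Phat (candidate g R k k' a i) = 1)"

end

theory Submission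
  imports Defs "HOL-Real_Asymp.Real_Asymp"
begin

text \<open>A user is served at share \<open>\<alpha>\<close> exactly when its power is at least
  \<open>share_power_ext g R \<alpha>\<close>, so only the outage pattern and the total power of an allocation matter
  for the Lagrangian.  Serving nobody costs at least power 0.  Serving one user alone is cheapest
  at full share, because the perspective \<open>\<alpha> (2 powr (R / \<alpha>) - 1)\<close> of an exponential decreases
  in \<open>\<alpha>\<close>.  Serving both users costs at least the minimum of \<open>total_power\<close>.  Hence each feasible
  allocation is dominated by the candidate with the same or a better outage pattern, and
  that candidate respects the peak power because it uses no more power.\<close>

section \<open>Convexity and monotonicity of the power needed at a positive share\<close>

lemma powr_convex_combination:
  fixes u v x y b :: real
  assumes "0 \<le> u" "0 \<le> v" "u + v = 1" "0 < b"
  shows "b powr (u * x + v * y) \<le> u * b powr x + v * b powr y"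
proof -
  have "exp (u *\<^sub>R (x * ln b) + v *\<^sub>R (y * ln b)) \<le> u * exp (x * ln b) + v * exp (y * ln b)"
    using exp_convex assms unfolding convex_on_def by simp
  then show ?thesis
    using assms by (simp add: powr_def algebra_simps)
qed

lemma share_power_nonneg:
  assumes "0 < g" "0 \<le> R" "0 \<le> \<alpha>"
  shows "0 \<le> share_power g R \<alpha>"
  using assms by (simp add: share_power_def ge_one_powr_ge_zero)

text \<open>This is the perspective argument: with \<open>z = u * x + v * y\<close>, the weights
  \<open>u * x / z\<close> and \<open>v * y / z\<close> sum to 1 and average the exponents
  \<open>R / x\<close> and \<open>R / y\<close> to \<open>R / z\<close>. Convexity of the
  exponential, multiplied by \<open>z\<close>, gives the claim.\<close>

lemma share_power_convex:
  assumes "0 < g" "0 < x" "0 < y" "0 \<le> u" "0 \<le> v" "u + v = 1"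
  shows "share_power g R (u * x + v * y) \<le> u * share_power g R x + v * share_power g R y"
proof -
  define z where "z = u * x + v * y"
  have z: "0 < z"
    unfolding z_def using assms
    by (metis add.right_neutral add_0 add_nonneg_pos add_pos_nonneg less_eq_real_def mult_pos_pos
        mult_zero_left zero_neq_one)
  have weights: "u * x / z + v * y / z = 1"
    using z by (simp add: z_def flip: add_divide_distrib)
  have exponent: "u * x / z * (R / x) + v * y / z * (R / y) = R / z"
    using assms by (simp flip: add_divide_distrib distrib_right)
  have "2 powr (R / z) \<le> u * x / z * 2 powr (R / x) + v * y / z * 2 powr (R / y)"
    using powr_convex_combination[of "u * x / z" "v * y / z" 2 "R / x" "R / y"] assms z weights exponent
    by simp
  then have "z * 2 powr (R / z) \<le> z * (u * x / z * 2 powr (R / x) + v * y / z * 2 powr (R / y))"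
    using z by (simp add: mult_left_mono)
  also have "\<dots> = u * x * 2 powr (R / x) + v * y * 2 powr (R / y)"
    using z by (simp add: distrib_left)
  finally have "z * (2 powr (R / z) - 1) \<le>
      u * (x * (2 powr (R / x) - 1)) + v * (y * (2 powr (R / y) - 1))"
    by (simp add: z_def algebra_simps)
  then have "z * (2 powr (R / z) - 1) / g \<le>
      (u * (x * (2 powr (R / x) - 1)) + v * (y * (2 powr (R / y) - 1))) / g"
    using \<open>0 < g\<close> by (simp add: divide_right_mono)
  then show ?thesis
    by (simp add: share_power_def z_def add_divide_distrib)
qed

text \<open>The exponent \<open>R\<close> is the convex combination of \<open>R / \<alpha>\<close>
  and 0 with weights \<open>\<alpha>\<close> and \<open>1 - \<alpha>\<close>, so convexity of the
  exponential suffices.\<close>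

lemma share_power_full_le:
  assumes "0 < g" "0 < \<alpha>" "\<alpha> \<le> 1"
  shows "share_power g R 1 \<le> share_power g R \<alpha>"
proof -
  have "2 powr R - 1 \<le> \<alpha> * (2 powr (R / \<alpha>) - 1)"
    using powr_convex_combination[of \<alpha> "1 - \<alpha>" 2 "R / \<alpha>" 0] assms by (simp add: algebra_simps)
  then show ?thesis
    using assms by (simp add: share_power_def divide_right_mono)
qed

section \<open>The extended power function as the service threshold\<close>

lemma share_power_ext_nonneg:
  assumes "0 < g" "0 \<le> R" "0 \<le> \<alpha>"
  shows "0 \<le> share_power_ext g R \<alpha>"
  using share_power_nonneg[OF assms] by (simp add: share_power_ext_def)

lemma share_power_ext_rate_zero: "share_power_ext g 0 \<alpha> = 0"
  by (simp add: share_power_ext_def share_power_def)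

text \<open>At share 0 a finite value forces \<open>R = 0\<close>, and there the default value of
  division by zero makes \<open>share_power\<close> equal to 0 as well.\<close>

lemma share_power_ext_finite:
  assumes "share_power_ext g R \<alpha> \<noteq> \<infinity>"
  shows "share_power_ext g R \<alpha> = ereal (share_power g R \<alpha>)"
  using assms by (auto simp: share_power_ext_def share_power_def split: if_splits)

lemma share_power_ext_full_le:
  assumes "0 < g" "0 \<le> R" "0 \<le> \<alpha>" "\<alpha> \<le> 1"
  shows "ereal (share_power g R 1) \<le> share_power_ext g R \<alpha>"
  using share_power_full_le[of g \<alpha> R] assms
  by (auto simp: share_power_ext_def share_power_def)

text \<open>For a positive share this solves the rate inequality for \<open>p\<close>. At share 0
  the rate is 0, so only a zero target is met, which is what the values 0 and \<infinity> of
  \<open>share_power_ext\<close> encode.\<close>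

lemma outage_eq_0_iff:
  assumes "0 < g" "0 \<le> R" "0 \<le> \<alpha>" "0 \<le> p"
  shows "outage g R \<alpha> p = 0 \<longleftrightarrow> share_power_ext g R \<alpha> \<le> ereal p"
proof (cases "\<alpha> = 0")
  case True
  then show ?thesis
    using assms by (auto simp: outage_def oma_rate_def share_power_ext_def)
next
  case False
  then have \<alpha>: "0 < \<alpha>" using assms by simp
  have "0 < 1 + p * g / \<alpha>"
    using assms by (simp add: add_pos_nonneg)
  then have "R / \<alpha> \<le> log 2 (1 + p * g / \<alpha>) \<longleftrightarrow> 2 powr (R / \<alpha>) \<le> 1 + p * g / \<alpha>"
    by (simp add: le_log_iff)
  then show ?thesis
    using \<alpha> \<open>0 < g\<close> by (auto simp: outage_def oma_rate_def share_power_ext_def share_power_def field_simps)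
qed

lemma outage_cases: "outage g R \<alpha> p = 0 \<or> outage g R \<alpha> p = 1"
  by (simp add: outage_def)

section \<open>Convexity of the total power and existence of a minimizer\<close>

lemma share_power_ext_convex:
  assumes "0 < g" "0 \<le> R" "0 \<le> x" "0 \<le> y" "0 \<le> u" "0 \<le> v" "u + v = 1"
  shows "share_power_ext g R (u * x + v * y) \<le>
    ereal u * share_power_ext g R x + ereal v * share_power_ext g R y"
proof -
  consider "R = 0" | "u = 0" | "v = 0" | "0 < x" "0 < y"
    | "0 < R" "0 < u" "0 < v" "x = 0 \<or> y = 0"
    using assms by linarith
  then show ?thesis
  proof cases
    case 1
    then show ?thesis by (simp add: share_power_ext_rate_zero)
  next
    \<comment> \<open>In \<open>ereal\<close> the product of 0 and \<infinity> is 0, so a vanishing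
      weight removes its term even at share 0.\<close>
    case 2
    then show ?thesis using assms by (simp add: one_ereal_def[symmetric] zero_ereal_def[symmetric])
  next
    case 3
    then show ?thesis using assms by (simp add: one_ereal_def[symmetric] zero_ereal_def[symmetric])
  next
    case 4
    then have "u * x + v * y \<noteq> 0"
      using assms by (metis add_nonneg_eq_0_iff mult_eq_0_iff mult_nonneg_nonneg order_less_irrefl
          add_0 zero_neq_one)
    with 4 show ?thesis
      using share_power_convex[of g x y u v R] assms by (simp add: share_power_ext_def)
  next
    \<comment> \<open>An endpoint at share 0 carries positive weight and infinite power, so the
      right-hand side is \<infinity>.\<close>
    case 5
    have "0 \<le> ereal u * share_power_ext g R x" "0 \<le> ereal v * share_power_ext g R y"
      using share_power_ext_nonneg assms by simp_all
    moreover have "ereal u * share_power_ext g R x = \<infinity> \<or> ereal v * share_power_ext g R y = \<infinity>"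
      using 5 by (auto simp: share_power_ext_def)
    ultimately show ?thesis by auto
  qed
qed

lemma total_power_convex:
  assumes "0 < g k" "0 < g k'" "0 \<le> R k" "0 \<le> R k'"
  shows "ereal_convex_on {0..1} (total_power g R k k')"
  unfolding ereal_convex_on_def
proof (intro conjI ballI allI impI)
  fix x y u v :: real
  assume xy: "x \<in> {0..1}" "y \<in> {0..1}" and uv: "0 \<le> u" "0 \<le> v" "u + v = 1"
  define f where "f = share_power_ext (g k) (R k)"
  define h where "h = share_power_ext (g k') (R k')"
  have nonneg: "0 \<le> f x" "0 \<le> f y" "0 \<le> h (1 - x)" "0 \<le> h (1 - y)"
    using xy assms by (simp_all add: f_def h_def share_power_ext_nonneg)
  have share: "1 - (u * x + v * y) = u * (1 - x) + v * (1 - y)"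
    using uv by (simp add: algebra_simps)
  have "f (u * x + v * y) + h (1 - (u * x + v * y)) \<le>
      (ereal u * f x + ereal v * f y) + (ereal u * h (1 - x) + ereal v * h (1 - y))"
    unfolding share f_def h_def using xy uv assms
    by (intro add_mono share_power_ext_convex) auto
  \<comment> \<open>Distributivity in \<open>ereal\<close> can fail for infinities of opposite sign;
    nonnegativity rules these out.\<close>
  also have "\<dots> = ereal u * (f x + h (1 - x)) + ereal v * (f y + h (1 - y))"
    using nonneg by (simp add: ereal_right_distrib add_ac)
  finally show "total_power g R k k' (u * x + v * y) \<le>
      ereal u * total_power g R k k' x + ereal v * total_power g R k k' y"
    by (simp add: total_power_def f_def h_def)
qed simp

text \<open>For \<open>R > 0\<close> the power blows up as the share tends to 0, matching the value
  \<infinity> there. Continuity up to the endpoint is what lets compactness of the closed interval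
  yield a minimizer.\<close>

lemma continuous_on_share_power_ext:
  assumes "0 < g" "0 \<le> R"
  shows "continuous_on {0..} (share_power_ext g R)"
proof (cases "R = 0")
  case True
  then show ?thesis by (simp add: share_power_ext_rate_zero)
next
  case False
  then have R: "0 < R" using assms by simp
  show ?thesis
    unfolding continuous_on_def
  proof
    fix x :: real assume x: "x \<in> {0..}"
    show "(share_power_ext g R \<longlongrightarrow> share_power_ext g R x) (at x within {0..})"
    proof (cases "x = 0")
      case True
      have "filterlim (\<lambda>\<alpha>. \<alpha> * (2 powr (R / \<alpha>) - 1) / g) at_top (at_right 0)"
        using R assms by real_asymp
      then have "((\<lambda>\<alpha>. ereal (share_power g R \<alpha>)) \<longlongrightarrow> \<infinity>) (at_right 0)"
        by (simp add: tendsto_PInfty_eq_at_top share_power_def)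
      then have "(share_power_ext g R \<longlongrightarrow> \<infinity>) (at_right 0)"
        by (rule Lim_transform_eventually)
          (auto simp: eventually_at_filter share_power_ext_def)
      then show ?thesis
        using True R by (simp add: share_power_ext_def at_within_Ici_at_right)
    next
      case False
      then have pos: "0 < x" using x by simp
      have "((\<lambda>\<alpha>. ereal (share_power g R \<alpha>)) \<longlongrightarrow> ereal (share_power g R x)) (at x)"
        unfolding share_power_def using False assms by (intro tendsto_intros) auto
      moreover have "\<forall>\<^sub>F \<alpha> in at x. ereal (share_power g R \<alpha>) = share_power_ext g R \<alpha>"
        by (rule eventually_mono[OF order_tendstoD(1)[OF tendsto_ident_at pos]])
          (simp add: share_power_ext_def)
      ultimately have "(share_power_ext g R \<longlongrightarrow> ereal (share_power g R x)) (at x)"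
        by (rule Lim_transform_eventually)
      then show ?thesis
        using False by (simp add: share_power_ext_def tendsto_within_subset[where S=UNIV])
    qed
  qed
qed

lemma total_power_attains_min:
  assumes "0 < g k" "0 < g k'" "0 \<le> R k" "0 \<le> R k'"
  shows "\<exists>a. is_arg_min (total_power g R k k') (\<lambda>\<alpha>. \<alpha> \<in> {0..1}) a"
proof -
  have "continuous_on {0..1} (share_power_ext (g k) (R k))"
    using assms by (intro continuous_on_subset[OF continuous_on_share_power_ext]) auto
  moreover have "continuous_on {0..1} (\<lambda>\<alpha>. share_power_ext (g k') (R k') (1 - \<alpha>))"
    using assms
    by (intro continuous_on_compose2[OF continuous_on_share_power_ext] continuous_intros) auto
  \<comment> \<open>Both summands are nonnegative, so no sum of opposite infinities breaks
    continuity of addition.\<close>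
  ultimately have "continuous_on {0..1} (total_power g R k k')"
    unfolding continuous_on_def total_power_def
    by (auto intro!: tendsto_add_ereal_nonneg simp: share_power_ext_nonneg assms eventually_at_filter)
  then obtain a where "a \<in> {0..1}" "\<forall>\<alpha>\<in>{0..1}. total_power g R k k' a \<le> total_power g R k k' \<alpha>"
    using continuous_attains_inf[of "{0..1}"] by (metis atLeastAtMost_iff compact_Icc empty_iff
        less_eq_real_def zero_less_one)
  then show ?thesis
    by (auto simp: is_arg_min_linorder)
qed

section \<open>Comparison of feasible allocations with the candidates\<close>

lemma lagrangian_mono:
  assumes "outage (g k) (R k) \<alpha> p \<le> outage (g k) (R k) \<beta> q"
    and "outage (g k') (R k') (1 - \<alpha>) p' \<le> outage (g k') (R k') (1 - \<beta>) q'"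
    and "p + p' \<le> q + q'"
    and "0 \<le> R k" "0 \<le> R k'" "0 \<le> lam" "0 \<le> \<delta>" "0 \<le> \<mu>"
  shows "lagrangian g R k k' lam \<delta> \<mu> (p, p', \<alpha>) \<le> lagrangian g R k k' lam \<delta> \<mu> (q, q', \<beta>)"
  unfolding lagrangian_def Let_def using assms
  by (auto intro!: add_mono mult_left_mono)

text \<open>The total power is finite at the equal split 1/2, hence finite at a minimizer, and so is
  each of its summands.\<close>

lemma minimizer_share_powers:
  assumes "0 < g k" "0 < g k'" "0 \<le> R k" "0 \<le> R k'"
    and "is_arg_min (total_power g R k k') (\<lambda>\<alpha>. \<alpha> \<in> {0..1}) a"
  shows "share_power_ext (g k) (R k) a = ereal (share_power (g k) (R k) a)"
    and "share_power_ext (g k') (R k') (1 - a) = ereal (share_power (g k') (R k') (1 - a))"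
proof -
  have "total_power g R k k' a \<le> total_power g R k k' (1 / 2)"
    using assms(5) by (auto simp: is_arg_min_linorder)
  also have "\<dots> < \<infinity>"
    by (simp add: total_power_def share_power_ext_def)
  finally have "total_power g R k k' a \<noteq> \<infinity>"
    by simp
  then show "share_power_ext (g k) (R k) a = ereal (share_power (g k) (R k) a)"
    and "share_power_ext (g k') (R k') (1 - a) = ereal (share_power (g k') (R k') (1 - a))"
    by (auto simp: total_power_def intro: share_power_ext_finite)
qed

text \<open>The indicator tests only the sum of the powers; nonnegativity of each power and the
  range of the share hold for every candidate.\<close>

lemma candidate_feasible:
  assumes "0 < g k" "0 < g k'" "0 \<le> R k" "0 \<le> R k'" "a \<in> {0..1}"
    and "peak_indicator Phat (candidate g R k k' a i) = 1"
  shows "feasible Phat (candidate g R k k' a i)"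
  using assms
  by (auto simp: feasible_def candidate_def peak_indicator_def share_power_nonneg
      ge_one_powr_ge_zero split: if_splits)

lemma candidate_dominates:
  assumes gains: "0 < g k" "0 < g k'"
    and rates: "0 \<le> R k" "0 \<le> R k'"
    and multipliers: "0 \<le> lam" "0 \<le> \<delta>" "0 \<le> \<mu>"
    and a: "is_arg_min (total_power g R k k') (\<lambda>\<alpha>. \<alpha> \<in> {0..1}) a"
    and x: "feasible Phat x"
  shows "\<exists>i\<in>{1, 2, 3, 4}. peak_indicator Phat (candidate g R k k' a i) = 1 \<and>
    lagrangian g R k k' lam \<delta> \<mu> (candidate g R k k' a i) \<le> lagrangian g R k k' lam \<delta> \<mu> x"
proof -
  obtain q q' \<beta> where x_eq: "x = (q, q', \<beta>)"
    by (cases x)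
  have q: "0 \<le> q" "0 \<le> q'" "q + q' \<le> Phat" and \<beta>: "0 \<le> \<beta>" "\<beta> \<le> 1"
    using x by (auto simp: x_eq feasible_def)
  have a01: "0 \<le> a" "a \<le> 1"
    and a_min: "total_power g R k k' a \<le> total_power g R k k' \<beta>"
    using a \<beta> by (auto simp: is_arg_min_linorder)
  \<comment> \<open>Each outage pattern below only has to name a candidate that is no worse in both
    outages and in total power; its peak constraint is then inherited from \<open>x\<close>.\<close>
  have dominates: ?thesis
    if "i \<in> {1, 2, 3, 4}" "candidate g R k k' a i = (p, p', \<alpha>)" "0 \<le> p" "0 \<le> p'" "p + p' \<le> q + q'"
      "outage (g k) (R k) \<alpha> p \<le> outage (g k) (R k) \<beta> q"
      "outage (g k') (R k') (1 - \<alpha>) p' \<le> outage (g k') (R k') (1 - \<beta>) q'" for i p p' \<alpha>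
  proof (rule bexI[of _ i], intro conjI)
    show "peak_indicator Phat (candidate g R k k' a i) = 1"
      using that q by (simp add: peak_indicator_def)
    show "lagrangian g R k k' lam \<delta> \<mu> (candidate g R k k' a i) \<le> lagrangian g R k k' lam \<delta> \<mu> x"
      unfolding that(2) x_eq using that rates multipliers by (intro lagrangian_mono)
  qed (use that in simp)
  have le1: "outage G r \<alpha> p \<le> 1" for G r \<alpha> p
    by (simp add: outage_def)
  note served = outage_eq_0_iff[OF gains(1) rates(1)] outage_eq_0_iff[OF gains(2) rates(2)]
  note sp_nonneg = share_power_nonneg[OF gains(1) rates(1)] share_power_nonneg[OF gains(2) rates(2)]
  consider
      (none) "outage (g k) (R k) \<beta> q = 1" "outage (g k') (R k') (1 - \<beta>) q' = 1"
    | (first) "outage (g k) (R k) \<beta> q = 0" "outage (g k') (R k') (1 - \<beta>) q' = 1"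
    | (second) "outage (g k) (R k) \<beta> q = 1" "outage (g k') (R k') (1 - \<beta>) q' = 0"
    | (both) "outage (g k) (R k) \<beta> q = 0" "outage (g k') (R k') (1 - \<beta>) q' = 0"
    using outage_cases by metis
  then show ?thesis
  proof cases
    case none
    show ?thesis
      by (rule dominates[of 1 0 0 0]) (use none q le1 in \<open>auto simp: candidate_def\<close>)
  next
    case first
    \<comment> \<open>At full share the formula becomes the power of the second candidate. The other
      user's outage is bounded by 1 only, since a zero target would be met even without
      resources.\<close>
    define p where "p = share_power (g k) (R k) 1"
    have "ereal p \<le> ereal q"
      using share_power_ext_full_le[OF gains(1) rates(1) \<beta>] first(1) served(1)[OF \<beta>(1) q(1)]
      unfolding p_def by (meson order_trans)
    moreover have "outage (g k) (R k) 1 p = 0"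
      using sp_nonneg by (simp add: served p_def share_power_ext_def)
    ultimately show ?thesis
      using first q le1 sp_nonneg(1)[of 1]
      by (intro dominates[of 2 p 0 1]) (auto simp: candidate_def p_def share_power_def)
  next
    case second
    define p where "p = share_power (g k') (R k') 1"
    have "ereal p \<le> ereal q'"
      using share_power_ext_full_le[OF gains(2) rates(2), of "1 - \<beta>"] second(2)
        served(2)[of "1 - \<beta>" q'] \<beta> q
      unfolding p_def by (meson diff_ge_0_iff_ge diff_left_mono order_trans diff_le_eq le_add_same_cancel1)
    moreover have "outage (g k') (R k') 1 p = 0"
      using sp_nonneg by (simp add: served p_def share_power_ext_def)
    ultimately show ?thesis
      using second q le1 sp_nonneg(2)[of 1]
      by (intro dominates[of 3 0 p 0]) (auto simp: candidate_def p_def share_power_def)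
  next
    case both
    define p where "p = share_power (g k) (R k) a"
    define p' where "p' = share_power (g k') (R k') (1 - a)"
    have p_eq: "share_power_ext (g k) (R k) a = ereal p"
      "share_power_ext (g k') (R k') (1 - a) = ereal p'"
      using minimizer_share_powers[of g k k' R, OF gains rates a] by (simp_all add: p_def p'_def)
    have "ereal (p + p') = total_power g R k k' a"
      by (simp add: total_power_def p_eq)
    also note a_min
    \<comment> \<open>Both users being served bounds each summand by the power actually
      spent.\<close>
    also have "total_power g R k k' \<beta> \<le> ereal q + ereal q'"
      unfolding total_power_def using both \<beta> q by (intro add_mono) (simp_all add: served)
    finally have "p + p' \<le> q + q'"
      by simp
    moreover have "0 \<le> p" "0 \<le> p'"
      using sp_nonneg a01 by (simp_all add: p_def p'_def)
    \<comment> \<open>The powers meet the service thresholds with equality.\<close>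
    moreover from this have "outage (g k) (R k) a p = 0" "outage (g k') (R k') (1 - a) p' = 0"
      using a01 by (simp_all add: served p_eq)
    ultimately show ?thesis
      using both by (intro dominates[of 4 p p' a]) (auto simp: candidate_def p_def p'_def)
  qed
qed

theorem proposition4p2:
  fixes g R :: "nat \<Rightarrow> real" and k k' :: nat and Phat lam \<delta> \<mu> :: real
  assumes users: "{k, k'} = {1, 2}"
    and gains: "0 < g k" "0 < g k'"
    and rates: "0 \<le> R k" "0 \<le> R k'"
    and peak: "0 \<le> Phat"
    and multipliers: "0 \<le> lam" "0 \<le> \<delta>" "0 \<le> \<mu>"
  shows "ereal_convex_on {0..1} (total_power g R k k') \<and>
    (\<exists>a. is_arg_min (total_power g R k k') (\<lambda>\<alpha>. \<alpha> \<in> {0..1}) a) \<and>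
    (\<forall>a. is_arg_min (total_power g R k k') (\<lambda>\<alpha>. \<alpha> \<in> {0..1}) a \<longrightarrow>
       (\<exists>i. best_candidate g R k k' lam \<delta> \<mu> Phat a i) \<and>
       (\<forall>i. best_candidate g R k k' lam \<delta> \<mu> Phat a i \<longrightarrow>
          is_arg_min (lagrangian g R k k' lam \<delta> \<mu>) (feasible Phat) (candidate g R k k' a i)))"
proof (intro conjI allI impI)
  show "ereal_convex_on {0..1} (total_power g R k k')"
    using gains rates by (rule total_power_convex)
  show "\<exists>a. is_arg_min (total_power g R k k') (\<lambda>\<alpha>. \<alpha> \<in> {0..1}) a"
    using gains rates by (rule total_power_attains_min)
next
  fix a
  define I where "I = {i \<in> {1, 2, 3, 4}. peak_indicator Phat (candidate g R k k' a i) = 1}"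
  \<comment> \<open>The zero-power candidate always respects the peak, so the finite set to minimize
    over is nonempty.\<close>
  have "1 \<in> I"
    using peak by (simp add: I_def candidate_def peak_indicator_def)
  moreover have "finite I"
    by (simp add: I_def)
  ultimately obtain i where
    "is_arg_min (\<lambda>i. lagrangian g R k k' lam \<delta> \<mu> (candidate g R k k' a i)) (\<lambda>i. i \<in> I) i"
    using ex_is_arg_min_if_finite[of I] by blast
  then show "\<exists>i. best_candidate g R k k' lam \<delta> \<mu> Phat a i"
    unfolding best_candidate_def I_def by auto
next
  fix a i
  assume a: "is_arg_min (total_power g R k k') (\<lambda>\<alpha>. \<alpha> \<in> {0..1}) a"
    and i: "best_candidate g R k k' lam \<delta> \<mu> Phat a i"
  have "feasible Phat (candidate g R k k' a i)"
    using candidate_feasible[of g k k' R a Phat i] gains rates a i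
    by (simp add: is_arg_min_def best_candidate_def)
  \<comment> \<open>The best candidate is at most the admissible candidate dominating
    \<open>x\<close>, hence at most \<open>x\<close>.\<close>
  moreover have "lagrangian g R k k' lam \<delta> \<mu> (candidate g R k k' a i) \<le> lagrangian g R k k' lam \<delta> \<mu> x"
    if x: "feasible Phat x" for x
    using candidate_dominates[of g k k' R lam \<delta> \<mu> a Phat x, OF gains rates multipliers a x] i
    unfolding best_candidate_def is_arg_min_linorder by (meson order_trans)
  ultimately show "is_arg_min (lagrangian g R k k' lam \<delta> \<mu>) (feasible Phat) (candidate g R k k' a i)"
    by (simp add: is_arg_min_linorder)
qed

end
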